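(* Let $m\ge 4$ be an integer and let $QD_{2^m}=\langle a,b : a^{2^{m-1}}=b^2=1,\ bab^{-1}=a^{2^{m-2}-1}\rangle$ be the quasidihedral group. Then $\mathrm{OSCom}(QD_{2^m})\cong K_{2^m}$.
   Context: For a finite group $G$, the order super commuting graph $\mathrm{OSCom}(G)$ is the simple graph with vertex set $G$ in which two distinct vertices $g,h$ are adjacent if and only if either $g$ and $h$ have the same order, or there exist $g',h'\in G$ such that $g'$ has the same order as $g$, $h'$ has the same order as $h$, and $g'h'=h'g'$. $K_r$ is the complete graph on $r$ vertices. *)

theory Defs
  imports
    "HOL-Algebra.Multiplicative_Group"
    "Graph_Theory.Digraph_Isomorphism"
    "Graph_Theory.Kuratowski"
begin

section \<open>Groups given by generators and relations\<close>

datatype 'g letter = Gen 'g | Inv 'g  \<comment> \<open>a generator or its formal inverse\<close>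

type_synonym 'g word = "'g letter list"

text \<open>
  The least congruence on words that cancels adjacent inverse letters and identifies the two
  sides of every relation; a pair \<open>(u, v) \<in> R\<close> stands for the relation \<open>u = v\<close>.
\<close>

inductive pres_cong :: "('g word \<times> 'g word) set \<Rightarrow> 'g word \<Rightarrow> 'g word \<Rightarrow> bool"
  for R :: "('g word \<times> 'g word) set" where
  refl: "pres_cong R u u"
| sym: "pres_cong R u v \<Longrightarrow> pres_cong R v u"
| trans: "pres_cong R u v \<Longrightarrow> pres_cong R v w \<Longrightarrow> pres_cong R u w"
| append: "pres_cong R u u' \<Longrightarrow> pres_cong R v v' \<Longrightarrow> pres_cong R (u @ v) (u' @ v')"
| cancel_right: "pres_cong R [Gen x, Inv x] []"
| cancel_left: "pres_cong R [Inv x, Gen x] []"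
| relation: "(u, v) \<in> R \<Longrightarrow> pres_cong R u v"

definition pres_rel :: "('g word \<times> 'g word) set \<Rightarrow> ('g word \<times> 'g word) set" where
  "pres_rel R = {(u, v). pres_cong R u v}"

text \<open>
  The generating set is the whole type \<^typ>\<open>'g\<close>. The union in the multiplication is the usual
  lifting of concatenation to congruence classes, so the product of the classes of \<open>u\<close> and \<open>v\<close>
  is the class of \<open>u @ v\<close> (lemma \<open>presented_group_mult\<close>).
\<close>

definition presented_group :: "('g word \<times> 'g word) set \<Rightarrow> 'g word set monoid" where
  "presented_group R =
     \<lparr>carrier = UNIV // pres_rel R,
      monoid.mult = (\<lambda>X Y. \<Union>u\<in>X. \<Union>v\<in>Y. pres_rel R `` {u @ v}),
      one = pres_rel R `` {[]}\<rparr>"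

lemma equiv_pres_rel: "equiv UNIV (pres_rel R)"
  unfolding equiv_def refl_on_def sym_def trans_def pres_rel_def
  by (auto intro: pres_cong.refl pres_cong.sym pres_cong.trans)

lemma pres_rel_class_eq_iff:
  "pres_rel R `` {u} = pres_rel R `` {v} \<longleftrightarrow> pres_cong R u v"
  using eq_equiv_class_iff[OF equiv_pres_rel, of u v] by (simp add: pres_rel_def)

lemma presented_group_mult:
  "pres_rel R `` {u} \<otimes>\<^bsub>presented_group R\<^esub> pres_rel R `` {v} = pres_rel R `` {u @ v}"
proof -
  have "(\<lambda>u v. pres_rel R `` {u @ v}) respects2 pres_rel R"
    by (rule congruent2I')
       (simp add: pres_rel_class_eq_iff, simp add: pres_rel_def pres_cong.append)
  then show ?thesis
    unfolding presented_group_def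
    by (simp add: UN_equiv_class2[OF equiv_pres_rel equiv_pres_rel])
qed

fun inv_letter :: "'g letter \<Rightarrow> 'g letter" where
  "inv_letter (Gen x) = Inv x"
| "inv_letter (Inv x) = Gen x"

lemma pres_cong_inv_word: "pres_cong R (rev (map inv_letter w) @ w) []"
proof (induction w)
  case (Cons l w)
  have "pres_cong R [inv_letter l, l] []"
    by (cases l) (auto intro: pres_cong.intros)
  from pres_cong.append[OF pres_cong.append[OF pres_cong.refl this] pres_cong.refl,
      of "rev (map inv_letter w)" w]
  have "pres_cong R (rev (map inv_letter (l # w)) @ l # w) (rev (map inv_letter w) @ w)"
    by simp
  then show ?case
    using Cons.IH by (rule pres_cong.trans)
qed (simp add: pres_cong.refl)

lemma group_presented_group: "group (presented_group R)"
proof (rule groupI)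
  let ?G = "presented_group R"
  have carrier: "X \<in> carrier ?G \<longleftrightarrow> (\<exists>u. X = pres_rel R `` {u})" for X
    by (auto simp: presented_group_def quotient_def)
  have one: "\<one>\<^bsub>?G\<^esub> = pres_rel R `` {[]}"
    by (simp add: presented_group_def)
  show "X \<otimes>\<^bsub>?G\<^esub> Y \<in> carrier ?G" if "X \<in> carrier ?G" "Y \<in> carrier ?G" for X Y
    using that by (auto simp: carrier presented_group_mult)
  show "\<one>\<^bsub>?G\<^esub> \<in> carrier ?G"
    by (auto simp: carrier one)
  show "X \<otimes>\<^bsub>?G\<^esub> Y \<otimes>\<^bsub>?G\<^esub> Z = X \<otimes>\<^bsub>?G\<^esub> (Y \<otimes>\<^bsub>?G\<^esub> Z)"
    if "X \<in> carrier ?G" "Y \<in> carrier ?G" "Z \<in> carrier ?G" for X Y Z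
    using that by (auto simp: carrier presented_group_mult)
  show "\<one>\<^bsub>?G\<^esub> \<otimes>\<^bsub>?G\<^esub> X = X" if "X \<in> carrier ?G" for X
    using that by (auto simp: carrier one presented_group_mult)
  show "\<exists>Y\<in>carrier ?G. Y \<otimes>\<^bsub>?G\<^esub> X = \<one>\<^bsub>?G\<^esub>" if X: "X \<in> carrier ?G" for X
  proof -
    obtain u where u: "X = pres_rel R `` {u}"
      using X carrier by blast
    have "pres_rel R `` {rev (map inv_letter u)} \<otimes>\<^bsub>?G\<^esub> X = \<one>\<^bsub>?G\<^esub>"
      by (simp add: u one presented_group_mult pres_rel_class_eq_iff pres_cong_inv_word)
    then show ?thesis
      using carrier by blast
  qed
qed


section \<open>The quasidihedral group\<close>

datatype qd_gen = A | B

text \<open>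
  Intended for \<open>m \<ge> 4\<close>, where none of the subtractions on \<^typ>\<open>nat\<close> truncates.
\<close>

definition quasidihedral :: "nat \<Rightarrow> qd_gen word set monoid" where
  "quasidihedral m = presented_group
     {(replicate (2 ^ (m - 1)) (Gen A), []),
      ([Gen B, Gen B], []),
      ([Gen B, Gen A, Inv B], replicate (2 ^ (m - 2) - 1) (Gen A))}"


section \<open>Graphs\<close>

text \<open>
  As in \<^locale>\<open>graph\<close>, a simple graph is a loop-free symmetric digraph without parallel arcs.
\<close>

definition OSCom :: "('a, 'b) monoid_scheme \<Rightarrow> 'a pair_pre_digraph" where
  "OSCom G =
     \<lparr>pverts = carrier G,
      parcs = {(g, h). g \<in> carrier G \<and> h \<in> carrier G \<and> g \<noteq> h \<and>
        (group.ord G g = group.ord G h \<or>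
         (\<exists>g'\<in>carrier G. \<exists>h'\<in>carrier G.
            group.ord G g' = group.ord G g \<and> group.ord G h' = group.ord G h \<and>
            g' \<otimes>\<^bsub>G\<^esub> h' = h' \<otimes>\<^bsub>G\<^esub> g'))}\<rparr>"

definition complete_graph :: "nat \<Rightarrow> nat pair_pre_digraph" where
  "complete_graph r =
     \<lparr>pverts = {..<r}, parcs = {(u, v). u < r \<and> v < r \<and> u \<noteq> v}\<rparr>"

lemma complete_digraph_complete_graph: "complete_digraph r (with_proj (complete_graph r))"
  by (auto simp: complete_digraph_pair_def complete_graph_def)

lemma graph_OSCom:
  assumes "finite (carrier G)"
  shows "graph (with_proj (OSCom G))"
proof -
  have "parcs (OSCom G) \<subseteq> carrier G \<times> carrier G"
    by (auto simp: OSCom_def)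
  then have fin: "finite (parcs (OSCom G))"
    using assms by (meson finite_SigmaI finite_subset)
  have sym: "symmetric (with_proj (OSCom G))"
    unfolding symmetric_def sym_def by (simp add: OSCom_def) metis
  show ?thesis
    using fin assms sym
    by unfold_locales (auto simp: OSCom_def arc_to_ends_def)
qed

end

theory Submission
  imports Defs
begin

text \<open>
  Write \<open>q = 2 ^ (m - 3)\<close>, so that \<open>a\<close> has order \<open>4q\<close> and \<open>b a b\<^sup>-\<^sup>1 = a\<^bsup>2q-1\<^esup>\<close>. Every element is a
  power \<open>a\<^sup>i\<close> or a product \<open>a\<^sup>i b\<close>, and \<open>(a\<^sup>i b)\<^sup>2 = a\<^bsup>2qi\<^esup>\<close>. Hence \<open>a\<^sup>i b\<close> has order 2, like
  \<open>a\<^bsup>2q\<^esup>\<close>, when \<open>i\<close> is even, and order 4, like \<open>a\<^sup>q\<close>, when \<open>i\<close> is odd. So every element has the order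
  of some power of \<open>a\<close> (\<open>ord_eq_ord_power\<close>). Powers of \<open>a\<close> commute, therefore any two elements are
  adjacent and the graph is complete.

  What remains is that the presentation does not collapse: \<open>a\<close> has order exactly \<open>4q\<close>, and there are
  \<open>8q = 2 ^ m\<close> elements. The relations make the \<open>8q\<close> products \<open>a\<^sup>i b\<^sup>r\<close> with \<open>i < 4q\<close>, \<open>r < 2\<close> exhaust
  the group. To see that these are distinct, let the letters act on the \<open>8q\<close> exponent pairs \<open>(i, r)\<close>
  as right multiplication acts on the products \<open>a\<^sup>i b\<^sup>r\<close>. The action respects the relations
  (\<open>run_cong\<close>), so the pair reached from \<open>(0, 0)\<close> is an invariant of the group element, and it takes
  every value.
\<close>

section \<open>Complete graphs\<close>

lemma digraph_iso_complete_graph: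
  assumes "finite (pverts G)"
    and "parcs G = {(u, v). u \<in> pverts G \<and> v \<in> pverts G \<and> u \<noteq> v}"
  shows "digraph_iso (with_proj G) (with_proj (complete_graph (card (pverts G))))"
proof -
  obtain f where f: "bij_betw f (pverts G) {..<card (pverts G)}"
    using ex_bij_betw_finite_nat[OF assms(1)] by (auto simp: atLeast0LessThan)
  have inj: "inj_on f (pverts G)" and img: "f ` pverts G = {..<card (pverts G)}"
    using f by (auto simp: bij_betw_def)
  let ?h = "\<lparr>iso_verts = f, iso_arcs = map_prod f f, iso_head = snd, iso_tail = fst\<rparr>"
  have wf: "wf_digraph (with_proj G)"
    by unfold_locales (auto simp: assms(2))
  have "inj_on (map_prod f f) (parcs G)"
    using inj by (auto simp: assms(2) inj_on_def)
  then have "pre_digraph.digraph_isomorphism (with_proj G) ?h"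
    using wf inj by (auto simp: pre_digraph.digraph_isomorphism_def)
  moreover have "map_prod f f ` parcs G
      = {(u, v). u \<in> f ` pverts G \<and> v \<in> f ` pverts G \<and> u \<noteq> v}"
    using inj by (force simp: assms(2) dest: inj_onD)
  then have "with_proj (complete_graph (card (pverts G))) = app_iso ?h (with_proj G)"
    by (simp add: app_iso_def with_proj_def complete_graph_def img)
  ultimately show ?thesis
    unfolding digraph_iso_def by blast
qed

section \<open>Orders in a group with a quasidihedral relation\<close>

context group
begin

lemma mult_pow_commute:
  assumes "a \<in> carrier G" "b \<in> carrier G" "b \<otimes> a = a [^] (k::nat) \<otimes> b"
  shows "b \<otimes> a [^] (i::nat) = a [^] (k * i) \<otimes> b"
proof (induction i)
  case (Suc i)
  have "b \<otimes> a [^] Suc i = (b \<otimes> a [^] i) \<otimes> a"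
    using assms by (simp add: m_assoc)
  also have "\<dots> = a [^] (k * i) \<otimes> (b \<otimes> a)"
    using Suc assms by (simp add: m_assoc)
  also have "\<dots> = a [^] (k * i) \<otimes> a [^] k \<otimes> b"
    using assms by (simp add: m_assoc)
  finally show ?case
    using assms by (simp add: nat_pow_mult add.commute)
qed (use assms in simp)

lemma pow_mult_involution_square:
  assumes "a \<in> carrier G" "b \<in> carrier G" "b \<otimes> a = a [^] (k::nat) \<otimes> b" "b \<otimes> b = \<one>"
  shows "(a [^] (i::nat) \<otimes> b) [^] (2::nat) = a [^] ((k + 1) * i)"
proof -
  have "(a [^] i \<otimes> b) [^] (2::nat) = a [^] i \<otimes> ((b \<otimes> a [^] i) \<otimes> b)"
    using assms by (simp add: numeral_2_eq_2 m_assoc)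
  also have "\<dots> = a [^] i \<otimes> (a [^] (k * i) \<otimes> (b \<otimes> b))"
    using assms by (simp add: mult_pow_commute[of a b k i] m_assoc)
  also have "\<dots> = a [^] ((k + 1) * i)"
    using assms by (simp add: nat_pow_mult)
  finally show ?thesis .
qed

lemma ord_eq_2:
  assumes "x \<in> carrier G" "x [^] (2::nat) = \<one>" "x \<noteq> \<one>"
  shows "ord x = 2"
proof -
  have "ord x dvd 2" "ord x \<noteq> 1"
    using assms by (simp add: pow_eq_id, simp add: ord_eq_1 del: One_nat_def)
  then show ?thesis
    using dvd_imp_le[of "ord x" 2] by (cases "ord x") auto
qed

lemma ord_eq_4:
  assumes "x \<in> carrier G" "ord (x [^] (2::nat)) = 2"
  shows "ord x = 4"
proof -
  have "x [^] (4::nat) = (x [^] (2::nat)) [^] (2::nat)"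
    using assms by (simp add: nat_pow_pow)
  also have "\<dots> = \<one>"
    using assms by (metis nat_pow_closed pow_ord_eq_1)
  finally have "ord x dvd 4"
    using assms by (simp add: pow_eq_id)
  moreover have "\<not> ord x dvd 2"
    using assms ord_id by (auto simp flip: pow_eq_id)
  moreover have "d \<in> {1, 2, 4}" if "d dvd 4" for d :: nat
  proof -
    have "d \<le> 4" "d \<noteq> 0" "d \<noteq> 3" using that by (auto dest: dvd_imp_le intro!: Nat.gr0I)
    then show ?thesis by auto
  qed
  ultimately show ?thesis by fastforce
qed

text \<open>
  The exponent of \<open>a\<close> in \<open>(a\<^sup>i b)\<^sup>2 = a\<^bsup>2qi\<^esup>\<close> matters only modulo \<open>4q\<close>, so the square is \<open>\<one>\<close> or the
  involution \<open>a\<^bsup>2q\<^esup>\<close> according to the parity of \<open>i\<close>.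
\<close>

lemma ord_eq_ord_power:
  assumes a: "a \<in> carrier G" and b: "b \<in> carrier G"
    and ord_a: "ord a = 4 * q" and q: "q > 0"
    and ba: "b \<otimes> a = a [^] (2 * q - 1) \<otimes> b" and bb: "b \<otimes> b = \<one>"
  shows "\<exists>j::nat. ord (a [^] j) = ord (a [^] (i::nat) \<otimes> b)"
proof -
  let ?x = "a [^] i \<otimes> b"
  have x: "?x \<in> carrier G"
    using a b by simp
  have square: "?x [^] (2::nat) = a [^] (2 * q * i)"
    using pow_mult_involution_square[OF a b ba bb, of i] q by simp
  have ord_2q: "ord (a [^] (2 * q)) = 2"
    using ord_pow[OF a, of "2 * q"] ord_a q by simp
  consider "?x = \<one>" | "?x \<noteq> \<one>" "even i" | "odd i"
    by blast
  then show ?thesis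
  proof cases
    case 1
    then have "ord (a [^] (0::nat)) = ord ?x"
      by simp
    then show ?thesis ..
  next
    case 2
    then have "a [^] (2 * q * i) = \<one>"
      using a ord_a by (auto simp: pow_eq_id)
    then have "ord ?x = 2"
      using 2 x square by (intro ord_eq_2) simp_all
    then show ?thesis
      using ord_2q by metis
  next
    case 3
    then obtain t where "i = 2 * t + 1"
      by (elim oddE)
    then have "2 * q * i = 2 * q + 4 * q * t"
      by (simp add: algebra_simps)
    moreover have "a [^] (4 * q * t) = \<one>"
      using a ord_a by (simp add: pow_eq_id)
    ultimately have "?x [^] (2::nat) = a [^] (2 * q)"
      using square a by (simp flip: nat_pow_mult)
    then have "ord ?x = 4"
      using x ord_2q by (intro ord_eq_4) simp_all
    moreover have "ord (a [^] q) = 4"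
      using ord_pow[OF a, of q] ord_a q by simp
    ultimately show ?thesis
      by metis
  qed
qed

end

section \<open>Normal forms for the quasidihedral presentation\<close>

definition qd_relations :: "nat \<Rightarrow> (qd_gen word \<times> qd_gen word) set" where
  "qd_relations q =
     {(replicate (4 * q) (Gen A), []),
      ([Gen B, Gen B], []),
      ([Gen B, Gen A, Inv B], replicate (2 * q - 1) (Gen A))}"

lemma quasidihedral_eq:
  assumes "m \<ge> 3"
  shows "quasidihedral m = presented_group (qd_relations (2 ^ (m - 3)))"
proof -
  obtain s where "m = s + 3"
    using assms that[of "m - 3"] by simp
  then have "m - 1 = s + 2" "m - 2 = s + 1" "m - 3 = s"
    by simp_all
  then show ?thesis
    by (simp add: quasidihedral_def qd_relations_def power_add)
qed

text \<open>
  The pair \<open>(i, r)\<close> stands for \<open>a\<^sup>i b\<^sup>r\<close>; a letter acts on it as right multiplication does. Moving \<open>a\<close>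
  to the left past \<open>b\<close> turns it into \<open>a\<^bsup>2q-1\<^esup>\<close>. The inverse of \<open>a\<close> acts as \<open>a\<^bsup>4q-1\<^esup>\<close>, which keeps the
  exponents natural numbers.
\<close>

definition twist :: "nat \<Rightarrow> bool \<Rightarrow> nat" where
  "twist q r = (if r then 2 * q - 1 else 1)"

fun step :: "nat \<Rightarrow> qd_gen letter \<Rightarrow> nat \<times> bool \<Rightarrow> nat \<times> bool" where
  "step q (Gen A) (i, r) = ((i + twist q r) mod (4 * q), r)"
| "step q (Inv A) (i, r) = ((i + twist q r * (4 * q - 1)) mod (4 * q), r)"
| "step q (Gen B) (i, r) = (i, \<not> r)"
| "step q (Inv B) (i, r) = (i, \<not> r)"

abbreviation run :: "nat \<Rightarrow> qd_gen word \<Rightarrow> nat \<times> bool \<Rightarrow> nat \<times> bool" where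
  "run q \<equiv> fold (step q)"

lemma step_bound: "fst s < 4 * q \<Longrightarrow> fst (step q l s) < 4 * q"
  by (cases "(q, l, s)" rule: step.cases) auto

lemma run_bound: "fst s < 4 * q \<Longrightarrow> fst (run q w s) < 4 * q"
  by (induction w arbitrary: s) (auto simp: step_bound)

lemma step_A_funpow:
  "i < 4 * q \<Longrightarrow> (step q (Gen A) ^^ n) (i, r) = ((i + n * twist q r) mod (4 * q), r)"
  by (induction n) (simp_all add: mod_simps algebra_simps)

text \<open>The automorphism \<open>a \<mapsto> a\<^bsup>2q-1\<^esup>\<close> is an involution, because \<open>(2q - 1)\<^sup>2 = 4q (q - 1) + 1\<close>.\<close>

lemma twist_not:
  assumes "q > 0"
  shows "(i + twist q (\<not> r)) mod (4 * q) = (i + (2 * q - 1) * twist q r) mod (4 * q)"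
proof (cases r)
  case True
  obtain p where "q = Suc p"
    using assms gr0_conv_Suc by blast
  then have "i + (2 * q - 1) * (2 * q - 1) = (i + 1) + (4 * q) * p"
    by (simp add: algebra_simps)
  then show ?thesis
    using True by (simp only: twist_def mod_mult_self2) simp
qed (simp add: twist_def)

text \<open>
  The bound on the exponent is needed for cancellation: a letter \<open>a\<close> followed by its inverse reduces
  the exponent modulo \<open>4q\<close>, so it acts as the identity on reduced exponents only.
\<close>

lemma run_cong:
  assumes "pres_cong (qd_relations q) u v" "fst s < 4 * q"
  shows "run q u s = run q v s"
  using assms
proof (induction arbitrary: s rule: pres_cong.induct)
  case (append u u' v v')
  then show ?case
    by (simp add: run_bound)
next
  have cancel: "(i + c + c * (4 * q - 1)) mod (4 * q) = i" if "i < 4 * q" for i c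
  proof -
    have "i + c + c * (4 * q - 1) = i + (4 * q) * c"
      using that by (cases q) (simp_all add: algebra_simps)
    then show ?thesis
      using that by (simp only: mod_mult_self2) simp
  qed
  {
    case (cancel_right x)
    then show ?case
      by (cases x; cases s) (simp_all add: mod_simps cancel del: One_nat_def)
  next
    case (cancel_left x)
    then show ?case
      using cancel[of "fst s" "twist q (snd s)"]
      by (cases x; cases s) (simp_all add: mod_simps add_ac del: One_nat_def)
  }
next
  case (relation u v)
  obtain i r where s: "s = (i, r)"
    by fastforce
  have i: "i < 4 * q" and q: "q > 0"
    using relation.prems s by simp_all
  from relation.hyps consider
    "u = replicate (4 * q) (Gen A)" "v = []" | "u = [Gen B, Gen B]" "v = []"
    | "u = [Gen B, Gen A, Inv B]" "v = replicate (2 * q - 1) (Gen A)"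
    by (auto simp: qd_relations_def)
  then show ?case
    by cases (use i q in \<open>simp_all add: s step_A_funpow twist_not\<close>)
qed auto

section \<open>Order of the quasidihedral group\<close>

context
  fixes q :: nat
  assumes q: "q > 0"
begin

abbreviation (input) QD :: "qd_gen word set monoid" where
  "QD \<equiv> presented_group (qd_relations q)"

abbreviation (input) cls :: "qd_gen word \<Rightarrow> qd_gen word set" where
  "cls w \<equiv> pres_rel (qd_relations q) `` {w}"

interpretation QD: group QD
  by (rule group_presented_group)

lemma cls_carrier: "cls w \<in> carrier QD"
  by (auto simp: presented_group_def quotient_def)

lemma carrier_QD: "carrier QD = range cls"
  by (auto simp: presented_group_def quotient_def)

lemma cls_Nil: "cls [] = \<one>\<^bsub>QD\<^esub>"
  by (simp add: presented_group_def)

lemma cls_append: "cls (u @ v) = cls u \<otimes>\<^bsub>QD\<^esub> cls v"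
  by (simp add: presented_group_mult)

lemma cls_replicate: "cls (replicate n l) = cls [l] [^]\<^bsub>QD\<^esub> n"
proof (induction n)
  case (Suc n)
  have "cls (replicate (Suc n) l) = cls (replicate n l @ [l])"
    by (simp add: replicate_append_same)
  then show ?case
    using Suc by (simp add: cls_append)
qed (simp add: cls_Nil)

lemma cls_relation: "(u, v) \<in> qd_relations q \<Longrightarrow> cls u = cls v"
  by (simp add: pres_rel_class_eq_iff pres_cong.relation)

lemma run_eq_of_cls_eq: "cls u = cls v \<Longrightarrow> run q u (0, False) = run q v (0, False)"
  using q by (auto simp: pres_rel_class_eq_iff intro: run_cong)

lemma cls_Inv: "cls [Inv x] = inv\<^bsub>QD\<^esub> cls [Gen x]"
proof -
  have "cls [Inv x] \<otimes>\<^bsub>QD\<^esub> cls [Gen x] = \<one>\<^bsub>QD\<^esub>"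
    by (simp flip: cls_append cls_Nil add: pres_rel_class_eq_iff pres_cong.cancel_left)
  then show ?thesis
    by (metis QD.inv_equality cls_carrier)
qed

lemma B_B: "cls [Gen B] \<otimes>\<^bsub>QD\<^esub> cls [Gen B] = \<one>\<^bsub>QD\<^esub>"
proof -
  have "cls ([Gen B] @ [Gen B]) = cls []"
    by (rule cls_relation) (simp add: qd_relations_def)
  then show ?thesis
    by (simp only: cls_append cls_Nil)
qed

lemma inv_B: "inv\<^bsub>QD\<^esub> cls [Gen B] = cls [Gen B]"
  using B_B QD.inv_equality cls_carrier by blast

lemma B_A: "cls [Gen B] \<otimes>\<^bsub>QD\<^esub> cls [Gen A] = cls [Gen A] [^]\<^bsub>QD\<^esub> (2 * q - 1) \<otimes>\<^bsub>QD\<^esub> cls [Gen B]"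
proof -
  have "cls ([Gen B] @ [Gen A] @ [Inv B]) = cls (replicate (2 * q - 1) (Gen A))"
    by (rule cls_relation) (simp add: qd_relations_def)
  then have "cls [Gen B] \<otimes>\<^bsub>QD\<^esub> cls [Gen A] \<otimes>\<^bsub>QD\<^esub> inv\<^bsub>QD\<^esub> cls [Gen B]
      = cls [Gen A] [^]\<^bsub>QD\<^esub> (2 * q - 1)"
    by (simp only: cls_append cls_replicate cls_Inv QD.m_assoc cls_carrier QD.inv_closed)
  then show ?thesis
    by (metis QD.inv_solve_right' QD.m_closed QD.nat_pow_closed cls_carrier)
qed

text \<open>
  The pair reached by \<open>a\<^sup>n\<close> is \<open>(n mod 4q, False)\<close>, so \<open>a\<^sup>n\<close> is trivial only if \<open>4q\<close> divides \<open>n\<close>.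
\<close>

lemma ord_A: "QD.ord (cls [Gen A]) = 4 * q"
proof -
  have "cls [Gen A] [^]\<^bsub>QD\<^esub> n = \<one>\<^bsub>QD\<^esub> \<longleftrightarrow> 4 * q dvd n" for n :: nat
  proof
    assume "cls [Gen A] [^]\<^bsub>QD\<^esub> n = \<one>\<^bsub>QD\<^esub>"
    then have "run q (replicate n (Gen A)) (0, False) = run q [] (0, False)"
      by (intro run_eq_of_cls_eq) (simp add: cls_replicate cls_Nil)
    then show "4 * q dvd n"
      using q by (simp add: step_A_funpow twist_def mod_eq_0_iff_dvd)
  next
    assume "4 * q dvd n"
    then obtain t where n: "n = 4 * q * t" ..
    have "cls (replicate (4 * q) (Gen A)) = cls []"
      by (rule cls_relation) (simp add: qd_relations_def)
    then have "cls [Gen A] [^]\<^bsub>QD\<^esub> (4 * q) = \<one>\<^bsub>QD\<^esub>"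
      by (simp only: cls_replicate cls_Nil)
    then show "cls [Gen A] [^]\<^bsub>QD\<^esub> n = \<one>\<^bsub>QD\<^esub>"
      by (metis n QD.nat_pow_pow QD.nat_pow_one cls_carrier)
  qed
  then show ?thesis
    by (simp add: QD.ord_unique cls_carrier)
qed

fun elt :: "nat \<times> bool \<Rightarrow> qd_gen word set" where
  "elt (i, r) = cls [Gen A] [^]\<^bsub>QD\<^esub> i \<otimes>\<^bsub>QD\<^esub> (if r then cls [Gen B] else \<one>\<^bsub>QD\<^esub>)"

lemma pow_A_mod: "cls [Gen A] [^]\<^bsub>QD\<^esub> (i mod (4 * q)) = cls [Gen A] [^]\<^bsub>QD\<^esub> i"
proof -
  have "cls [Gen A] [^]\<^bsub>QD\<^esub> i
      = cls [Gen A] [^]\<^bsub>QD\<^esub> (4 * q * (i div (4 * q))) \<otimes>\<^bsub>QD\<^esub> cls [Gen A] [^]\<^bsub>QD\<^esub> (i mod (4 * q))"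
    by (simp only: QD.nat_pow_mult[OF cls_carrier] mult_div_mod_eq)
  also have "cls [Gen A] [^]\<^bsub>QD\<^esub> (4 * q * (i div (4 * q))) = \<one>\<^bsub>QD\<^esub>"
    by (simp only: QD.pow_eq_id[OF cls_carrier] ord_A dvd_triv_left)
  finally show ?thesis
    by (simp add: cls_carrier)
qed

lemma inv_A: "inv\<^bsub>QD\<^esub> cls [Gen A] = cls [Gen A] [^]\<^bsub>QD\<^esub> (4 * q - 1)"
proof -
  have "cls [Gen A] [^]\<^bsub>QD\<^esub> (4 * q - 1) \<otimes>\<^bsub>QD\<^esub> cls [Gen A] = cls [Gen A] [^]\<^bsub>QD\<^esub> Suc (4 * q - 1)"
    by simp
  also have "\<dots> = \<one>\<^bsub>QD\<^esub>"
    using q ord_A by (simp only: QD.pow_eq_id[OF cls_carrier]) simp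
  finally show ?thesis
    using QD.inv_equality QD.nat_pow_closed cls_carrier by blast
qed

lemma elt_mult_A:
  "elt (i, r) \<otimes>\<^bsub>QD\<^esub> cls [Gen A] [^]\<^bsub>QD\<^esub> j = elt ((i + twist q r * j) mod (4 * q), r)"
proof (cases r)
  case True
  have "elt (i, r) \<otimes>\<^bsub>QD\<^esub> cls [Gen A] [^]\<^bsub>QD\<^esub> j
      = cls [Gen A] [^]\<^bsub>QD\<^esub> i \<otimes>\<^bsub>QD\<^esub> (cls [Gen B] \<otimes>\<^bsub>QD\<^esub> cls [Gen A] [^]\<^bsub>QD\<^esub> j)"
    using True by (simp add: QD.m_assoc cls_carrier)
  also have "\<dots> = cls [Gen A] [^]\<^bsub>QD\<^esub> (i + (2 * q - 1) * j) \<otimes>\<^bsub>QD\<^esub> cls [Gen B]"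
    unfolding QD.mult_pow_commute[OF cls_carrier cls_carrier B_A]
    by (simp add: QD.m_assoc cls_carrier flip: QD.nat_pow_mult)
  finally show ?thesis
    using True by (simp add: pow_A_mod twist_def)
next
  case False
  then show ?thesis
    by (simp add: pow_A_mod twist_def cls_carrier QD.nat_pow_mult)
qed

text \<open>
  The action of the letters was modelled on right multiplication; the relations make the two agree.
  Reading a word letter by letter therefore brings it into the form \<open>a\<^sup>i b\<^sup>r\<close>.
\<close>

lemma elt_step: "elt s \<otimes>\<^bsub>QD\<^esub> cls [l] = elt (step q l s)"
proof -
  obtain i r where s: "s = (i, r)"
    by fastforce
  show ?thesis
  proof (cases l)
    case (Gen x)
    show ?thesis
    proof (cases x)
      case A
      then show ?thesis
        using elt_mult_A[of i r 1] Gen by (simp add: s cls_carrier del: elt.simps)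
    next
      case B
      then show ?thesis
        using Gen by (simp add: s QD.m_assoc B_B cls_carrier)
    qed
  next
    case (Inv x)
    show ?thesis
    proof (cases x)
      case A
      then show ?thesis
        using elt_mult_A[of i r "4 * q - 1"] Inv
        by (simp add: s cls_Inv inv_A del: elt.simps)
    next
      case B
      then show ?thesis
        using Inv by (simp add: s cls_Inv inv_B QD.m_assoc B_B cls_carrier)
    qed
  qed
qed

lemma cls_eq_elt_run: "cls w = elt (run q w (0, False))"
proof (induction w rule: rev_induct)
  case (snoc l w)
  then show ?case
    by (simp add: cls_append elt_step)
next
  case Nil
  then show ?case
    by (simp only: fold_simps elt.simps cls_Nil QD.nat_pow_0 QD.r_one QD.one_closed if_False id_apply)
qed

lemma carrier_QD_elt: "carrier QD = elt ` ({..<4 * q} \<times> UNIV)"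
proof -
  have "cls w \<in> elt ` ({..<4 * q} \<times> UNIV)" for w
  proof -
    have "run q w (0, False) \<in> {..<4 * q} \<times> UNIV"
      using q run_bound[of "(0, False)" q w] by (simp add: mem_Times_iff)
    then have "elt (run q w (0, False)) \<in> elt ` ({..<4 * q} \<times> UNIV)"
      by (rule imageI)
    then show ?thesis
      by (simp only: cls_eq_elt_run)
  qed
  moreover have "elt s \<in> carrier QD" for s
    by (cases s) (simp add: cls_carrier)
  ultimately show ?thesis
    unfolding carrier_QD by (intro equalityI image_subsetI)
qed

text \<open>The word spelling out \<open>a\<^sup>i b\<^sup>r\<close> leads from \<open>(0, False)\<close> to \<open>(i, r)\<close>, so the invariant recovers the pair.\<close>

lemma inj_on_elt: "inj_on elt ({..<4 * q} \<times> UNIV)"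
proof -
  let ?word = "\<lambda>(i, r). replicate i (Gen A) @ (if r then [Gen B] else [])"
  have "run q (?word s) (0, False) = s" if "s \<in> {..<4 * q} \<times> UNIV" for s
    using that q by (auto simp: step_A_funpow twist_def)
  moreover have "run q (?word s) (0, False) = run q (?word t) (0, False)" if "elt s = elt t" for s t
  proof -
    have "elt s = cls (?word s)" for s
      by (cases s) (simp add: cls_append cls_replicate cls_Nil cls_carrier)
    with that show ?thesis
      by (intro run_eq_of_cls_eq) simp
  qed
  ultimately show ?thesis
    unfolding inj_on_def by metis
qed

lemma card_carrier_QD: "card (carrier QD) = 8 * q"
  unfolding carrier_QD_elt card_image[OF inj_on_elt] by (simp add: card_cartesian_product)

section \<open>The order super commuting graph\<close>

lemma ord_eq_ord_power_A:
  assumes "x \<in> carrier QD"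
  obtains j :: nat where "QD.ord (cls [Gen A] [^]\<^bsub>QD\<^esub> j) = QD.ord x"
proof -
  obtain i r where x: "x = elt (i, r)"
    using assms carrier_QD_elt by auto
  show thesis
  proof (cases r)
    case True
    then show thesis
      using QD.ord_eq_ord_power[OF cls_carrier cls_carrier ord_A q B_A B_B, of i] x that by auto
  next
    case False
    then show thesis
      using x that[of i] by (simp add: cls_carrier)
  qed
qed

lemma OSCom_QD_complete:
  "parcs (OSCom QD) = {(g, h). g \<in> carrier QD \<and> h \<in> carrier QD \<and> g \<noteq> h}"
proof -
  have "\<exists>g'\<in>carrier QD. \<exists>h'\<in>carrier QD. QD.ord g' = QD.ord g \<and> QD.ord h' = QD.ord h \<and>
      g' \<otimes>\<^bsub>QD\<^esub> h' = h' \<otimes>\<^bsub>QD\<^esub> g'" if gh: "g \<in> carrier QD" "h \<in> carrier QD" for g h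
  proof -
    obtain i j :: nat where "QD.ord (cls [Gen A] [^]\<^bsub>QD\<^esub> i) = QD.ord g"
        "QD.ord (cls [Gen A] [^]\<^bsub>QD\<^esub> j) = QD.ord h"
      by (meson gh ord_eq_ord_power_A)
    moreover have "cls [Gen A] [^]\<^bsub>QD\<^esub> i \<otimes>\<^bsub>QD\<^esub> cls [Gen A] [^]\<^bsub>QD\<^esub> j
        = cls [Gen A] [^]\<^bsub>QD\<^esub> j \<otimes>\<^bsub>QD\<^esub> cls [Gen A] [^]\<^bsub>QD\<^esub> i"
      by (simp add: QD.nat_pow_mult cls_carrier add.commute)
    ultimately show ?thesis
      by (meson QD.nat_pow_closed cls_carrier)
  qed
  then show ?thesis
    unfolding OSCom_def by auto
qed

lemma digraph_iso_OSCom_QD: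
  "digraph_iso (with_proj (OSCom QD)) (with_proj (complete_graph (8 * q)))"
proof -
  have "pverts (OSCom QD) = carrier QD"
    by (simp add: OSCom_def)
  moreover have "finite (carrier QD)"
    by (simp add: carrier_QD_elt)
  ultimately show ?thesis
    using digraph_iso_complete_graph[of "OSCom QD"] OSCom_QD_complete card_carrier_QD by simp
qed

end

theorem corollary2p15:
  fixes m :: nat
  assumes "m \<ge> 4"
  shows "digraph_iso (with_proj (OSCom (quasidihedral m))) (with_proj (complete_graph (2 ^ m)))"
proof -
  obtain s where s: "m = s + 3"
    using assms that[of "m - 3"] by simp
  then have "2 ^ m = 8 * (2 ^ (m - 3) :: nat)"
    by (simp add: power_add)
  then show ?thesis
    using assms digraph_iso_OSCom_QD[of "2 ^ (m - 3)"] by (simp add: quasidihedral_eq)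
qed

end
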